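(* For every positive integer $n$ and every integer $k$ with $0 \le k \le n-1$, \[ R_{n,k} = D_{n,k}. \] Moreover, for $n \ge 2$ and $0 \le k \le n-1$, the numbers $R_{n,k}$ satisfy \[ R_{n,k} = \begin{cases} (n-k)R_{n-1,k-1} + (k+1)R_{n-1,k}, & \text{if } n \text{ is odd},\\ R_{n-1,k-1} - R_{n-1,k}, & \text{if } n \text{ is even},\end{cases} \] with the convention $R_{m,j} = 0$ when $j<0$ or $j > m-1$.
   Context: For a permutation $A = a_1a_2\cdots a_n$ of $[n]=\{1,\dots,n\}$, an ascent is an index $i$ ($1 \le i \le n-1$) with $a_i < a_{i+1}$, and an inversion is a pair $(i,j)$ with $1\le i<j\le n$ and $a_i > a_j$; ${\rm inv}(A)$ is the number of inversions, and $A$ is even (resp. odd) if ${\rm inv}(A)$ is even (resp. odd). Let $E(n,k)$ be the set of permutations of $[n]$ with exactly $k$ ascents, and let $B_{n,k}$, $C_{n,k}$ be the numbers of even, resp. odd, permutations in $E(n,k)$; the signed Eulerian number is $D_{n,k} = B_{n,k} - C_{n,k}$. A permutation is parity-alternate (a PAP) if its consecutive entries alternate between even and odd integers (e.g. $436125$, $7216345$). Let $\Xi(n,k)$ be the set of PAPs of $[n]$ with exactly $k$ ascents, $P_{n,k}$ the number of even permutations in $\Xi(n,k)$, $Q_{n,k}$ the number of odd ones, and $R_{n,k} = P_{n,k} - Q_{n,k}$. *)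

theory Defs
  imports "HOL-Combinatorics.Multiset_Permutations"
begin

text \<open>
  A permutation \<open>a\<^sub>1 \<dots> a\<^sub>n\<close> of \<open>{1..n}\<close> is the list of its values, an element of
  \<open>permutations_of_set {1..n}\<close>.  List positions start at 0, so \<open>a\<^sub>i\<close> is \<open>w ! (i - 1)\<close>; this
  shift of indices does not affect the numbers of ascents and inversions.
\<close>

definition ascents :: "nat list \<Rightarrow> nat set" where
  "ascents w = {i. Suc i < length w \<and> w ! i < w ! Suc i}"

definition inversions :: "nat list \<Rightarrow> (nat \<times> nat) set" where
  "inversions w = {(i, j). i < j \<and> j < length w \<and> w ! i > w ! j}"

definition inv_num :: "nat list \<Rightarrow> nat" where
  "inv_num w = card (inversions w)"

definition parity_alternate :: "nat list \<Rightarrow> bool" where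
  "parity_alternate w \<longleftrightarrow> (\<forall>i. Suc i < length w \<longrightarrow> (even (w ! i) \<longleftrightarrow> odd (w ! Suc i)))"

text \<open>
  The number of ascents \<open>k\<close> is an integer, so that \<open>k - 1\<close> is not truncated in recurrences.
\<close>

definition E_set :: "nat \<Rightarrow> int \<Rightarrow> nat list set" where
  "E_set n k = {w \<in> permutations_of_set {1..n}. int (card (ascents w)) = k}"

definition B_num :: "nat \<Rightarrow> int \<Rightarrow> nat" where
  "B_num n k = card {w \<in> E_set n k. even (inv_num w)}"

definition C_num :: "nat \<Rightarrow> int \<Rightarrow> nat" where
  "C_num n k = card {w \<in> E_set n k. odd (inv_num w)}"

definition D_num :: "nat \<Rightarrow> int \<Rightarrow> int" where
  "D_num n k = int (B_num n k) - int (C_num n k)"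

definition Xi_set :: "nat \<Rightarrow> int \<Rightarrow> nat list set" where
  "Xi_set n k =
     {w \<in> permutations_of_set {1..n}. parity_alternate w \<and> int (card (ascents w)) = k}"

definition P_num :: "nat \<Rightarrow> int \<Rightarrow> nat" where
  "P_num n k = card {w \<in> Xi_set n k. even (inv_num w)}"

definition Q_num :: "nat \<Rightarrow> int \<Rightarrow> nat" where
  "Q_num n k = card {w \<in> Xi_set n k. odd (inv_num w)}"

definition R_num :: "nat \<Rightarrow> int \<Rightarrow> int" where
  "R_num n k = int (P_num n k) - int (Q_num n k)"

text \<open>
  The convention \<open>R\<^bsub>m,j\<^esub> = 0\<close> for \<open>j < 0\<close> or \<open>j > m - 1\<close> needs no separate clause:
  \<open>Xi_set m j\<close> is empty for such \<open>j\<close>.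
\<close>

lemma R_num_eq_0:
  assumes "m \<ge> 1" and "j < 0 \<or> j > int m - 1"
  shows "R_num m j = 0"
proof -
  have "w \<notin> Xi_set m j" for w
  proof
    assume w: "w \<in> Xi_set m j"
    then have len: "length w = m" and j: "j = int (card (ascents w))"
      by (auto simp: Xi_set_def dest: length_finite_permutations_of_set)
    have "ascents w \<subseteq> {..<m - 1}"
      using len by (auto simp: ascents_def)
    from card_mono[OF _ this] have "card (ascents w) \<le> m - 1"
      by simp
    then show False
      using assms j by linarith
  qed
  then have "Xi_set m j = {}"
    by blast
  then show ?thesis
    by (simp add: R_num_def P_num_def Q_num_def)
qed

end

theory Submission
  imports Defs
begin

text \<open>
  If a permutation has two consecutive values \<open>a\<close>, \<open>a + 1\<close> at positions of the same parity,
  then these are not neighbours, so exchanging them keeps the ascents and flips the sign.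
  The permutations without such a pair are exactly the PAPs; exchanging the least such pair
  does not change which values stand at even positions, so it is an involution and \<open>R = D\<close>.
  It remains to prove the recurrences for \<open>D\<close> by inserting \<open>n\<close> into the permutations of
  \<open>[n - 1]\<close>.  For odd \<open>n\<close> the permutations with \<open>n\<close> at an even place are not PAPs and cancel
  by the same involution, so all places may be counted with the sign \<open>+1\<close>.  For even \<open>n\<close> the
  permutations \<open>u n v\<close> with nonempty \<open>u\<close> and \<open>v\<close> cancel by reversing the word and replacing
  each \<open>x < n\<close> by \<open>n - x\<close>, and only the first and the last place remain.
\<close>

text \<open>Reindexing along the bijection \<open>f\<close> turns the sum into its own
  negative.\<close>

lemma sum_sign_reversing_involution:
  fixes g :: "'a \<Rightarrow> int"
  assumes "\<And>x. x \<in> A \<Longrightarrow> f x \<in> A" "\<And>x. x \<in> A \<Longrightarrow> f (f x) = x" "\<And>x. x \<in> A \<Longrightarrow> g (f x) = - g x"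
  shows "sum g A = 0"
proof -
  have "sum g A = (\<Sum>x\<in>A. - g x)"
    by (rule sum.reindex_bij_witness[of A f f]) (use assms in auto)
  then show ?thesis by (simp add: sum_negf)
qed

lemma permutations_of_set_atLeastAtMostD:
  assumes "w \<in> permutations_of_set {1..n}"
  shows "distinct w" "set w = {1..n}" "length w = n"
  using assms length_finite_permutations_of_set[OF assms] by (auto simp: permutations_of_set_def)

section \<open>Ascents and inversions of lists\<close>

abbreviation asc :: "nat list \<Rightarrow> nat" where
  "asc w \<equiv> card (ascents w)"

lemma finite_ascents [simp]: "finite (ascents w)"
  by (rule finite_subset[of _ "{..<length w}"]) (auto simp: ascents_def)

lemma finite_inversions [simp]: "finite (inversions w)"
  by (rule finite_subset[of _ "{..<length w} \<times> {..<length w}"]) (auto simp: inversions_def)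

lemma asc_Nil [simp]: "asc [] = 0"
  by (simp add: ascents_def)

lemma inv_num_Nil [simp]: "inv_num [] = 0"
  by (simp add: inv_num_def inversions_def)

lemma asc_Cons: "asc (x # xs) = (if xs \<noteq> [] \<and> x < hd xs then 1 else 0) + asc xs"
proof -
  have "ascents (x # xs) = (if xs \<noteq> [] \<and> x < hd xs then {0} else {}) \<union> Suc ` ascents xs"
  proof (rule set_eqI)
    fix i
    show "i \<in> ascents (x # xs) \<longleftrightarrow>
        i \<in> (if xs \<noteq> [] \<and> x < hd xs then {0} else {}) \<union> Suc ` ascents xs"
      by (cases i) (auto simp: ascents_def hd_conv_nth)
  qed
  moreover have "card ((if xs \<noteq> [] \<and> x < hd xs then {0} else {}) \<union> Suc ` ascents xs)
      = card (if xs \<noteq> [] \<and> x < hd xs then {0::nat} else {}) + card (Suc ` ascents xs)"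
    by (rule card_Un_disjoint) auto
  ultimately show ?thesis by (simp add: card_image)
qed

lemma asc_append:
  "asc (u @ v) = asc u + asc v + (if u \<noteq> [] \<and> v \<noteq> [] \<and> last u < hd v then 1 else 0)"
  by (induction u) (auto simp: asc_Cons)

lemma inv_num_Cons: "inv_num (x # xs) = length (filter (\<lambda>y. y < x) xs) + inv_num xs"
proof -
  let ?A = "(\<lambda>j. (0::nat, Suc j)) ` {j. j < length xs \<and> xs ! j < x}"
  let ?B = "map_prod Suc Suc ` inversions xs"
  have "inversions (x # xs) = ?A \<union> ?B"
  proof (rule set_eqI)
    fix p :: "nat \<times> nat"
    obtain i j where p: "p = (i, j)" by (cases p)
    show "p \<in> inversions (x # xs) \<longleftrightarrow> p \<in> ?A \<union> ?B"
      unfolding p by (cases i; cases j) (auto simp: inversions_def map_prod_def image_iff)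
  qed
  moreover have "card (?A \<union> ?B) = card ?A + card ?B"
    by (rule card_Un_disjoint) auto
  moreover have "card ?A = length (filter (\<lambda>y. y < x) xs)"
    by (simp add: card_image inj_on_def length_filter_conv_card)
  moreover have "card ?B = card (inversions xs)"
    by (intro card_image) (auto simp: inj_on_def)
  ultimately show ?thesis by (simp add: inv_num_def)
qed

lemma inv_num_append:
  "inv_num (u @ v) = inv_num u + inv_num v + (\<Sum>x\<leftarrow>u. length (filter (\<lambda>y. y < x) v))"
  by (induction u) (auto simp: inv_num_Cons)

text \<open>The largest value is entered by an ascent and left by a descent, so the comparison
  between the end of \<open>u\<close> and the start of \<open>v\<close> disappears and only the
  emptiness of \<open>u\<close> matters.\<close>

lemma asc_insert_max:
  assumes "\<forall>x\<in>set u \<union> set v. x < n"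
  shows "asc (u @ n # v) = asc u + asc v + (if u \<noteq> [] then 1 else 0)"
proof -
  have "v \<noteq> [] \<Longrightarrow> hd v < n" "u \<noteq> [] \<Longrightarrow> last u < n"
    using assms hd_in_set[of v] last_in_set[of u] by blast+
  then show ?thesis by (auto simp: asc_append asc_Cons)
qed

lemma inv_num_insert_max:
  assumes "\<forall>x\<in>set u \<union> set v. x < n"
  shows "inv_num (u @ n # v) = inv_num (u @ v) + length v"
proof -
  have "filter (\<lambda>y. y < n) v = v" using assms by (auto simp: filter_id_conv)
  moreover have "map (\<lambda>x. length (filter (\<lambda>y. y < x) (n # v))) u
      = map (\<lambda>x. length (filter (\<lambda>y. y < x) v)) u"
    using assms by (auto dest: less_asym')
  ultimately show ?thesis by (simp only: inv_num_append inv_num_Cons)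
qed

section \<open>Reversal combined with complementation\<close>

definition rev_compl :: "nat \<Rightarrow> nat list \<Rightarrow> nat list" where
  "rev_compl n l = rev (map (\<lambda>x. n - x) l)"

lemma rev_compl_eq_Nil_iff [simp]: "rev_compl n l = [] \<longleftrightarrow> l = []"
  by (simp add: rev_compl_def)

text \<open>Reversal and complementation each turn an ascent into a descent, so together they keep
  it. The bound on the entries makes the truncated subtraction strictly order-reversing.\<close>

lemma asc_rev_compl:
  "\<forall>x\<in>set l. x \<le> n \<Longrightarrow> asc (rev_compl n l) = asc l"
proof (induction l)
  case (Cons x l)
  then have "l \<noteq> [] \<Longrightarrow> n - hd l < n - x \<longleftrightarrow> x < hd l"
    by (cases l) auto
  then show ?case
    using Cons by (auto simp: rev_compl_def asc_append asc_Cons last_rev hd_map)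
qed (simp add: rev_compl_def)

lemma inv_num_rev_compl:
  "\<forall>x\<in>set l. x \<le> n \<Longrightarrow> inv_num (rev_compl n l) = inv_num l"
proof (induction l)
  case (Cons x l)
  \<comment> \<open>The head \<open>x\<close> becomes the last entry \<open>n - x\<close>; the
    entries before it that exceed it come from the \<open>y < x\<close>.\<close>
  have "(\<Sum>y\<leftarrow>rev (map (\<lambda>x. n - x) l). length (filter (\<lambda>z. z < y) [n - x]))
      = length (filter (\<lambda>y. y < x) l)"
    using Cons.prems by (induction l) auto
  then show ?case
    using Cons by (simp add: rev_compl_def inv_num_append inv_num_Cons del: filter.simps)
qed (simp add: rev_compl_def)

section \<open>Signed sums\<close>

definition sg :: "nat list \<Rightarrow> int" where
  "sg w = (-1) ^ inv_num w"

lemma card_even_minus_card_odd: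
  assumes "finite A"
  shows "int (card {w \<in> A. even (inv_num w)}) - int (card {w \<in> A. odd (inv_num w)}) = sum sg A"
proof -
  have "sum sg A = sum sg {w \<in> A. even (inv_num w)} + sum sg {w \<in> A. odd (inv_num w)}"
    by (subst sum.union_disjoint[symmetric]) (use assms in \<open>auto intro!: sum.cong\<close>)
  also have "sum sg {w \<in> A. even (inv_num w)} = (\<Sum>w | w \<in> A \<and> even (inv_num w). 1)"
    by (rule sum.cong) (auto simp: sg_def)
  also have "sum sg {w \<in> A. odd (inv_num w)} = (\<Sum>w | w \<in> A \<and> odd (inv_num w). -1)"
    by (rule sum.cong) (auto simp: sg_def)
  finally show ?thesis by simp
qed

lemma finite_E_set [simp]: "finite (E_set n k)"
  by (simp add: E_set_def)

lemma finite_Xi_set [simp]: "finite (Xi_set n k)"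
  by (simp add: Xi_set_def)

lemma D_num_eq_sum: "D_num n k = sum sg (E_set n k)"
  by (simp add: D_num_def B_num_def C_num_def card_even_minus_card_odd)

lemma R_num_eq_sum: "R_num n k = sum sg (Xi_set n k)"
  by (simp add: R_num_def P_num_def Q_num_def card_even_minus_card_odd)

section \<open>Exchanging two consecutive values\<close>

text \<open>No integer lies strictly between \<open>a\<close> and \<open>a + 1\<close>, so swapping
  them affects only their comparison with each other.\<close>

lemma transpose_Suc_less_iff:
  fixes x y a :: nat
  assumes "x \<noteq> y" "{x, y} \<noteq> {a, Suc a}"
  shows "transpose a (Suc a) x < transpose a (Suc a) y \<longleftrightarrow> x < y"
  using assms by (auto simp: transpose_def)

lemma ascents_map_transpose:
  assumes "distinct w"
    and "\<And>i. Suc i < length w \<Longrightarrow> {w ! i, w ! Suc i} \<noteq> {a, Suc a}"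
  shows "ascents (map (transpose a (Suc a)) w) = ascents w"
  using assms transpose_Suc_less_iff by (auto simp: ascents_def nth_eq_iff_index_eq)

text \<open>Only the pair of positions carrying \<open>a\<close> and \<open>Suc a\<close> changes
  its status, so the two inversion sets differ in exactly one element.\<close>

lemma sg_map_transpose:
  assumes w: "distinct w" and i: "i < length w" "w ! i = a" and j: "j < length w" "w ! j = Suc a"
  shows "sg (map (transpose a (Suc a)) w) = - sg w"
proof -
  let ?w = "map (transpose a (Suc a)) w"
  \<comment> \<open>The two values may stand in either order, while an inversion lists the smaller
    position first.\<close>
  let ?p = "(min i j, max i j)"
  have ij: "i \<noteq> j" using i j by auto
  have *: "(p, q) \<in> inversions ?w \<longleftrightarrow> (p, q) \<in> inversions w"
    if "(p, q) \<noteq> ?p" for p q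
  proof (cases "p < q \<and> q < length w")
    case True
    have "{w ! q, w ! p} \<noteq> {a, Suc a}"
    proof
      assume "{w ! q, w ! p} = {a, Suc a}"
      then have "p = i \<and> q = j \<or> p = j \<and> q = i"
        using nth_eq_iff_index_eq[OF w] i j True by (metis doubleton_eq_iff order.strict_trans)
      then show False using True that by auto
    qed
    moreover have "w ! q \<noteq> w ! p" using True w by (simp add: nth_eq_iff_index_eq)
    ultimately show ?thesis
      using True transpose_Suc_less_iff[of "w ! q" "w ! p" a] by (simp add: inversions_def)
  qed (auto simp: inversions_def)
  have **: "?p \<in> inversions ?w \<longleftrightarrow> ?p \<notin> inversions w"
    using i j ij by (cases "i < j") (auto simp: inversions_def min_def max_def)
  define I where "I = inversions w - {?p}"
  have I: "finite I" "?p \<notin> I" by (auto simp: I_def)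
  have "inversions ?w - {?p} = I" unfolding I_def using * by auto
  then have "inversions w = insert ?p I \<and> inversions ?w = I \<or>
      inversions w = I \<and> inversions ?w = insert ?p I"
    using ** unfolding I_def by blast
  then show ?thesis using I by (auto simp: sg_def inv_num_def)
qed

section \<open>Parity of positions and the cancelling exchange\<close>

definition values_even_pos :: "nat list \<Rightarrow> nat set" where
  "values_even_pos w = {w ! i | i. i < length w \<and> even i}"

lemma nth_in_values_even_pos_iff:
  assumes "distinct w" "i < length w"
  shows "w ! i \<in> values_even_pos w \<longleftrightarrow> even i"
  using assms by (auto simp: values_even_pos_def nth_eq_iff_index_eq)

text \<open>This is why values are recorded instead of positions: exchanging two values fixes the
  set whenever both or neither belong to it.\<close>

lemma values_even_pos_map: "values_even_pos (map f w) = f ` values_even_pos w"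
  by (auto simp: values_even_pos_def image_iff) (metis nth_map)

lemma parity_alternate_iff:
  "parity_alternate w \<longleftrightarrow> (\<forall>i<length w. even (w ! i) \<longleftrightarrow> (even i \<longleftrightarrow> even (w ! 0)))"
proof
  assume *: "parity_alternate w"
  have "i < length w \<Longrightarrow> even (w ! i) \<longleftrightarrow> (even i \<longleftrightarrow> even (w ! 0))" for i
  proof (induction i)
    case (Suc i)
    then show ?case using * unfolding parity_alternate_def by (meson Suc_lessD even_Suc)
  qed simp
  then show "\<forall>i<length w. even (w ! i) \<longleftrightarrow> (even i \<longleftrightarrow> even (w ! 0))" by blast
qed (force simp: parity_alternate_def)

text \<open>The argument is the set \<open>S\<close> and not the word, so words with equal
  \<open>values_even_pos\<close> have the same least such \<open>a\<close>.\<close>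

definition same_pos_parity :: "nat \<Rightarrow> nat set \<Rightarrow> nat \<Rightarrow> bool" where
  "same_pos_parity n S a \<longleftrightarrow> 1 \<le> a \<and> a < n \<and> (a \<in> S \<longleftrightarrow> Suc a \<in> S)"

text \<open>In a PAP the parities of value and position agree throughout or differ throughout, so
  \<open>a\<close> and \<open>a + 1\<close> lie at positions of opposite parity. Conversely,
  membership in \<open>values_even_pos w\<close> then alternates going up from 1, so the parity of a
  value decides that of its position.\<close>

lemma parity_alternate_iff_no_same_pos_parity:
  assumes w: "w \<in> permutations_of_set {1..n}"
  shows "parity_alternate w \<longleftrightarrow> (\<nexists>a. same_pos_parity n (values_even_pos w) a)"
proof
  from w have d: "distinct w" and s: "set w = {1..n}" by (auto simp: permutations_of_set_def)
  note E = nth_in_values_even_pos_iff[OF d]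
  {
    assume "parity_alternate w"
    then have p: "\<forall>i<length w. even (w ! i) \<longleftrightarrow> (even i \<longleftrightarrow> even (w ! 0))"
      by (simp add: parity_alternate_iff)
    show "\<nexists>a. same_pos_parity n (values_even_pos w) a"
    proof
      assume "\<exists>a. same_pos_parity n (values_even_pos w) a"
      then obtain a where a: "same_pos_parity n (values_even_pos w) a" ..
      then have "a \<in> set w" "Suc a \<in> set w" using s by (auto simp: same_pos_parity_def)
      then obtain i j where "i < length w" "w ! i = a" "j < length w" "w ! j = Suc a"
        by (auto simp: in_set_conv_nth)
      moreover from this a have "even i \<longleftrightarrow> even j"
        using E[of i] E[of j] by (auto simp: same_pos_parity_def)
      ultimately show False using p by (metis even_Suc)
    qed
  next
    assume *: "\<nexists>a. same_pos_parity n (values_even_pos w) a"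
    have v: "1 \<le> v \<Longrightarrow> v \<le> n \<Longrightarrow>
        v \<in> values_even_pos w \<longleftrightarrow> (odd v \<longleftrightarrow> 1 \<in> values_even_pos w)" for v
    proof (induction v rule: dec_induct)
      case (step v)
      then show ?case using * by (auto simp: same_pos_parity_def)
    qed simp
    show "parity_alternate w"
      unfolding parity_alternate_def
    proof (intro allI impI)
      fix i assume i: "Suc i < length w"
      have "1 \<le> w ! k \<and> w ! k \<le> n" if "k < length w" for k
        using s that nth_mem[of k w] by auto
      with i v[of "w ! i"] v[of "w ! Suc i"] E[of i] E[of "Suc i"]
      show "even (w ! i) \<longleftrightarrow> odd (w ! Suc i)" by auto
    qed
  }
qed

text \<open>The predicate \<open>P\<close> can be arbitrary because the exchange preserves
  \<open>values_even_pos\<close>. Taken as always true it yields R = D; taken as absence of the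
  largest value it serves the recurrence for odd length.\<close>

lemma sum_sg_not_parity_alternate:
  "(\<Sum>w | w \<in> E_set n k \<and> \<not> parity_alternate w \<and> P (values_even_pos w). sg w) = 0"
proof -
  let ?A = "{w. w \<in> E_set n k \<and> \<not> parity_alternate w \<and> P (values_even_pos w)}"
  \<comment> \<open>\<open>m w\<close> depends on \<open>w\<close> only through
    \<open>values_even_pos w\<close>, so \<open>f\<close> selects the same pair again and undoes
    itself.\<close>
  define m where "m w = (LEAST a. same_pos_parity n (values_even_pos w) a)" for w
  define f where "f w = map (transpose (m w) (Suc (m w))) w" for w
  have f: "f w \<in> ?A \<and> f (f w) = w \<and> sg (f w) = - sg w" if w: "w \<in> ?A" for w
  proof -
    let ?a = "m w"
    let ?t = "transpose ?a (Suc ?a)"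
    have wp: "w \<in> permutations_of_set {1..n}" and d: "distinct w" and s: "set w = {1..n}"
      using w by (auto simp: E_set_def permutations_of_set_def)
    note E = nth_in_values_even_pos_iff[OF d]
    have bad: "same_pos_parity n (values_even_pos w) ?a"
      unfolding m_def using w parity_alternate_iff_no_same_pos_parity[OF wp]
      by (auto intro: LeastI)
    then have a: "?a \<in> {1..n}" "Suc ?a \<in> {1..n}"
      and aE: "?a \<in> values_even_pos w \<longleftrightarrow> Suc ?a \<in> values_even_pos w"
      by (auto simp: same_pos_parity_def)
    then obtain i j where ij: "i < length w" "w ! i = ?a" "j < length w" "w ! j = Suc ?a"
      using s by (metis in_set_conv_nth)
    then have par: "even i \<longleftrightarrow> even j" using aE E by metis
    have vf: "values_even_pos (f w) = values_even_pos w"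
      using aE by (auto simp: f_def values_even_pos_map image_iff transpose_def split: if_splits)
    have fp: "f w \<in> permutations_of_set {1..n}"
      using d s a by (auto simp: permutations_of_set_def f_def distinct_map)
    \<comment> \<open>The two values sit at positions of equal parity, whereas neighbouring
      positions differ in parity.\<close>
    have "{w ! p, w ! Suc p} \<noteq> {?a, Suc ?a}" if p: "Suc p < length w" for p
    proof
      assume "{w ! p, w ! Suc p} = {?a, Suc ?a}"
      then have "p = i \<and> Suc p = j \<or> p = j \<and> Suc p = i"
        using nth_eq_iff_index_eq[OF d] p ij by (metis Suc_lessD doubleton_eq_iff)
      then show False using par by auto
    qed
    then have "asc (f w) = asc w" by (simp add: f_def ascents_map_transpose d)
    moreover have "\<not> parity_alternate (f w)"
      using bad by (auto simp: parity_alternate_iff_no_same_pos_parity[OF fp] vf)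
    moreover have "f (f w) = w"
      using vf by (simp add: f_def m_def o_def)
    moreover have "sg (f w) = - sg w"
      unfolding f_def using sg_map_transpose[OF d] ij by blast
    ultimately show ?thesis using fp vf w by (auto simp: E_set_def)
  qed
  show ?thesis by (rule sum_sign_reversing_involution[of _ f]) (use f in blast)+
qed

theorem R_num_eq_D_num: "R_num n k = D_num n k"
proof -
  have "sum sg (E_set n k) = sum sg (Xi_set n k \<union>
      {w. w \<in> E_set n k \<and> \<not> parity_alternate w \<and> True})"
    by (rule sum.cong) (auto simp: E_set_def Xi_set_def)
  also have "\<dots> = sum sg (Xi_set n k)"
    using sum_sg_not_parity_alternate[of n k "\<lambda>_. True"]
    by (subst sum.union_disjoint) (auto simp: Xi_set_def)
  finally show ?thesis by (simp add: D_num_eq_sum R_num_eq_sum)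
qed

text \<open>For \<open>n = 2m + 1\<close> there are \<open>m + 1\<close> even indices but only
  \<open>m\<close> even values, so the even indices of a PAP carry the odd values. Indices start at
  0: these are the odd places counted from 1.\<close>

lemma parity_alternate_max_even_pos:
  assumes w: "w \<in> permutations_of_set {1..n}" and n: "odd n" and "parity_alternate w"
  shows "n \<in> values_even_pos w"
proof -
  from w have d: "distinct w" and s: "set w = {1..n}" and l: "length w = n"
    by (rule permutations_of_set_atLeastAtMostD)+
  have p: "\<And>i. i < n \<Longrightarrow> even (w ! i) \<longleftrightarrow> (even i \<longleftrightarrow> even (w ! 0))"
    using assms(3) l unfolding parity_alternate_iff by blast
  obtain m where m: "n = Suc (2 * m)" using n by (auto elim: oddE)
  have "odd (w ! 0)"
  proof
    assume "even (w ! 0)"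
    then have "w ! i \<in> {v \<in> {1..n}. even v}" if "i < n" "even i" for i
      using p[of i] that s l nth_mem[of i w] by simp
    then have "(\<lambda>i. w ! i) ` {i. i < n \<and> even i} \<subseteq> {v \<in> {1..n}. even v}"
      by blast
    moreover have "inj_on (\<lambda>i. w ! i) {i. i < n \<and> even i}"
      using d l by (auto simp: inj_on_def nth_eq_iff_index_eq)
    ultimately have "card {i. i < n \<and> even i} \<le> card {v \<in> {1..n}. even v}"
      by (intro card_inj_on_le) auto
    moreover have "{i. i < n \<and> even i} = (\<lambda>x. 2 * x) ` {..m}"
      by (auto simp: m elim!: evenE)
    moreover have "{v \<in> {1..n}. even v} = (\<lambda>x. 2 * x) ` {1..m}"
      by (auto simp: m elim!: evenE)
    ultimately show False by (simp add: card_image inj_on_def)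
  qed
  moreover have "n \<in> set w" using s m by auto
  then obtain i where "i < length w" "w ! i = n" by (auto simp: in_set_conv_nth)
  ultimately show ?thesis using p[of i] n l nth_in_values_even_pos_iff[OF d, of i] by metis
qed

section \<open>Inserting the largest value\<close>

definition insert_at :: "nat \<Rightarrow> nat list \<Rightarrow> nat \<Rightarrow> nat list" where
  "insert_at j w x = take j w @ x # drop j w"

lemma bij_betw_insert_at:
  "bij_betw (\<lambda>(w, j). insert_at j w (Suc n))
     (permutations_of_set {1..n} \<times> {..n}) (permutations_of_set {1..Suc n})"
proof (rule bij_betw_imageI)
  let ?f = "\<lambda>(w, j). insert_at j w (Suc n)"
  show "inj_on ?f (permutations_of_set {1..n} \<times> {..n})"
  proof (rule inj_onI, clarify)
    fix w i v j
    assume w: "w \<in> permutations_of_set {1..n}" and v: "v \<in> permutations_of_set {1..n}"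
      and i: "i \<le> n" and j: "j \<le> n"
      and eq: "insert_at i w (Suc n) = insert_at j v (Suc n)"
    have "set w = {1..n}" "set v = {1..n}" and l: "length w = n" "length v = n"
      using permutations_of_set_atLeastAtMostD[OF w] permutations_of_set_atLeastAtMostD[OF v] by auto
    \<comment> \<open>\<open>Suc n\<close> does not occur in \<open>w\<close>, so it occurs once in
      the common word and splits it uniquely.\<close>
    then have "Suc n \<notin> set (take i w)" "Suc n \<notin> set (drop i w)"
      using set_take_subset[of i w] set_drop_subset[of i w] by auto
    then have *: "take i w = take j v" "drop i w = drop j v"
      using eq by (auto simp: insert_at_def append_Cons_eq_iff)
    then have "w = v" by (metis append_take_drop_id)
    moreover have "i = j" using arg_cong[OF *(1), of length] i j l by simp
    ultimately show "w = v \<and> i = j" by simp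
  qed
  show "?f ` (permutations_of_set {1..n} \<times> {..n}) = permutations_of_set {1..Suc n}"
  proof (intro equalityI subsetI)
    fix x assume "x \<in> ?f ` (permutations_of_set {1..n} \<times> {..n})"
    then obtain w j where x: "x = insert_at j w (Suc n)"
      and d: "distinct w" and s: "set w = {1..n}"
      by (auto simp: permutations_of_set_def)
    have t: "set (take j w) \<union> set (drop j w) = {1..n}"
      by (metis s append_take_drop_id set_append)
    have "Suc n \<notin> set (take j w) \<union> set (drop j w)" unfolding t by simp
    moreover have "distinct (take j w @ drop j w)" using d by simp
    ultimately have "distinct x" unfolding x insert_at_def distinct_append by auto
    moreover have "set x = {1..Suc n}"
      using t by (simp add: x insert_at_def atLeastAtMostSuc_conv)
    ultimately show "x \<in> permutations_of_set {1..Suc n}"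
      by (simp add: permutations_of_set_def)
  next
    fix x assume x: "x \<in> permutations_of_set {1..Suc n}"
    then have "Suc n \<in> set x" by (auto simp: permutations_of_set_def)
    then obtain u v where uv: "x = u @ Suc n # v" by (meson split_list)
    have d: "distinct x" and s: "set x = {1..Suc n}"
      using x by (auto simp: permutations_of_set_def)
    have "set (u @ v) = set x - {Suc n}" using d by (auto simp: uv)
    also have "\<dots> = {1..n}" unfolding s by auto
    finally have uvp: "u @ v \<in> permutations_of_set {1..n}"
      using d by (simp add: uv permutations_of_set_def)
    moreover have "length u \<le> n"
      using permutations_of_set_atLeastAtMostD(3)[OF uvp] by simp
    moreover have "x = insert_at (length u) (u @ v) (Suc n)" by (simp add: uv insert_at_def)
    ultimately show "x \<in> ?f ` (permutations_of_set {1..n} \<times> {..n})"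
      by (auto intro!: image_eqI[of _ _ "(u @ v, length u)"])
  qed
qed

text \<open>Inside an ascent, the step up to \<open>n\<close> replaces the old ascent; at a descent
  or at the end it is new; at the front there is none. The front is a separate case because
  \<open>j - 1\<close> truncates there.\<close>

lemma asc_insert_at:
  assumes "\<forall>x\<in>set w. x < n" "j \<le> length w"
  shows "asc (insert_at j w n) = (if j = 0 \<or> j - 1 \<in> ascents w then asc w else Suc (asc w))"
proof -
  have "asc (insert_at j w n) = asc (take j w) + asc (drop j w) + (if take j w \<noteq> [] then 1 else 0)"
    unfolding insert_at_def
    by (rule asc_insert_max) (use assms(1) in \<open>auto dest: in_set_takeD in_set_dropD\<close>)
  moreover have "asc w = asc (take j w) + asc (drop j w) +
      (if take j w \<noteq> [] \<and> drop j w \<noteq> [] \<and> last (take j w) < hd (drop j w) then 1 else 0)"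
    by (metis append_take_drop_id asc_append)
  moreover have "take j w \<noteq> [] \<and> drop j w \<noteq> [] \<and> last (take j w) < hd (drop j w)
      \<longleftrightarrow> j \<noteq> 0 \<and> j - 1 \<in> ascents w"
  proof (cases "j \<noteq> 0 \<and> j < length w")
    case True
    then have "w \<noteq> []" by auto
    with True have "last (take j w) = w ! (j - 1)" "hd (drop j w) = w ! j"
      by (simp_all add: last_conv_nth hd_drop_conv_nth)
    then show ?thesis using True by (auto simp: ascents_def)
  qed (auto simp: ascents_def)
  ultimately show ?thesis using assms(2) by auto
qed

lemma sg_insert_at:
  assumes "\<forall>x\<in>set w. x < n" "j \<le> length w"
  shows "sg (insert_at j w n) = (-1) ^ (length w - j) * sg w"
proof -
  have "inv_num (take j w @ n # drop j w) = inv_num (take j w @ drop j w) + length (drop j w)"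
    by (rule inv_num_insert_max) (use assms(1) in \<open>auto dest: in_set_takeD in_set_dropD\<close>)
  then show ?thesis by (simp add: sg_def insert_at_def power_add)
qed

section \<open>Recurrences by the place of the largest value\<close>

lemma sum_E_set_Suc:
  fixes g :: "nat list \<Rightarrow> int"
  shows "(\<Sum>w | w \<in> E_set (Suc n) k. g w) =
    (\<Sum>w\<in>permutations_of_set {1..n}. \<Sum>j\<le>n.
       if int (asc (insert_at j w (Suc n))) = k then g (insert_at j w (Suc n)) else 0)"
proof -
  have "(\<Sum>w | w \<in> E_set (Suc n) k. g w) =
      (\<Sum>w\<in>permutations_of_set {1..Suc n}. if int (asc w) = k then g w else 0)"
    by (simp add: E_set_def sum.If_cases Int_def)
  also have "\<dots> = (\<Sum>(w, j)\<in>permutations_of_set {1..n} \<times> {..n}.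
      if int (asc (insert_at j w (Suc n))) = k then g (insert_at j w (Suc n)) else 0)"
    by (subst sum.reindex_bij_betw[OF bij_betw_insert_at, symmetric])
      (auto intro: sum.cong)
  finally show ?thesis by (simp add: sum.cartesian_product)
qed

lemma D_num_eq_sum_permutations:
  "D_num n k = (\<Sum>w\<in>permutations_of_set {1..n}. if int (asc w) = k then sg w else 0)"
  by (simp add: D_num_eq_sum E_set_def sum.If_cases Int_def)

text \<open>Words with \<open>Suc n\<close> at an odd index cancel, so the weight \<open>?h\<close>
  can be introduced without changing the sum. It compensates the sign of the insertion; what remains
  is to count the places that produce \<open>k\<close> ascents.\<close>

lemma D_num_odd:
  assumes n: "even n"
  shows "D_num (Suc n) k = (int (Suc n) - k) * D_num n (k - 1) + (k + 1) * D_num n k"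
proof -
  let ?h = "\<lambda>w. if Suc n \<in> values_even_pos w then 1 else -1 :: int"
  have "sum sg (E_set (Suc n) k) - (\<Sum>w | w \<in> E_set (Suc n) k. ?h w * sg w)
      = 2 * (\<Sum>w | w \<in> E_set (Suc n) k. if Suc n \<notin> values_even_pos w then sg w else 0)"
    by (simp add: sum_subtractf[symmetric] sum_distrib_left) (auto intro: sum.cong)
  \<comment> \<open>A PAP of odd length has its largest value at an even index, so every word
    counted here is already a non-PAP.\<close>
  also have "(\<Sum>w | w \<in> E_set (Suc n) k. if Suc n \<notin> values_even_pos w then sg w else 0) =
      (\<Sum>w | w \<in> E_set (Suc n) k \<and> \<not> parity_alternate w \<and> Suc n \<notin> values_even_pos w. sg w)"
    using parity_alternate_max_even_pos[of _ "Suc n"] n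
    by (intro sum.mono_neutral_cong_right) (auto simp: E_set_def)
  also have "\<dots> = 0" by (rule sum_sg_not_parity_alternate)
  finally have "D_num (Suc n) k = (\<Sum>w | w \<in> E_set (Suc n) k. ?h w * sg w)"
    by (simp add: D_num_eq_sum)
  also have "\<dots> = (\<Sum>w\<in>permutations_of_set {1..n}.
      (int (Suc n) - k) * (if int (asc w) = k - 1 then sg w else 0) +
      (k + 1) * (if int (asc w) = k then sg w else 0))"
    unfolding sum_E_set_Suc
  proof (rule sum.cong[OF refl])
    fix w assume w: "w \<in> permutations_of_set {1..n}"
    then have d: "distinct w" and s: "set w = {1..n}" and l: "length w = n"
      by (rule permutations_of_set_atLeastAtMostD)+
    have m: "\<forall>x\<in>set w. x < Suc n" using s by auto
    \<comment> \<open>The places that keep the number of ascents: the front and the gap inside each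
      ascent.\<close>
    define K where "K = insert 0 (Suc ` ascents w)"
    have K: "K \<subseteq> {..n}" using l by (auto simp: K_def ascents_def)
    then have fK: "finite K" by (rule finite_subset) simp
    have cK: "card K = Suc (asc w)"
      unfolding K_def by (subst card_insert_disjoint) (auto simp: card_image)
    have "(if int (asc (insert_at j w (Suc n))) = k
            then ?h (insert_at j w (Suc n)) * sg (insert_at j w (Suc n)) else 0) =
        (if j \<in> K then (if int (asc w) = k then sg w else 0)
         else (if int (asc w) = k - 1 then sg w else 0))" if j: "j \<le> n" for j
    proof -
      have "insert_at j w (Suc n) ! j = Suc n" "j < length (insert_at j w (Suc n))"
        using j l by (auto simp: insert_at_def nth_append)
      moreover have "distinct (insert_at j w (Suc n))"
        using w j bij_betwE[OF bij_betw_insert_at[of n]]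
        by (fastforce simp: permutations_of_set_def)
      ultimately have "Suc n \<in> values_even_pos (insert_at j w (Suc n)) \<longleftrightarrow> even j"
        using nth_in_values_even_pos_iff by metis
      \<comment> \<open>As \<open>n\<close> is even, \<open>n - j\<close> and \<open>j\<close> have
        the same parity, so weight and insertion sign multiply to 1.\<close>
      then have "?h (insert_at j w (Suc n)) * sg (insert_at j w (Suc n)) = sg w"
        using sg_insert_at[OF m, of j] j l n by (auto simp: minus_one_power_iff)
      moreover have "j \<in> K \<longleftrightarrow> j = 0 \<or> j - 1 \<in> ascents w"
        by (cases j) (auto simp: K_def)
      ultimately show ?thesis using asc_insert_at[OF m, of j] j l by auto
    qed
    then have "(\<Sum>j\<le>n. if int (asc (insert_at j w (Suc n))) = k
            then ?h (insert_at j w (Suc n)) * sg (insert_at j w (Suc n)) else 0) =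
        (\<Sum>j\<le>n. if j \<in> K then (if int (asc w) = k then sg w else 0)
         else (if int (asc w) = k - 1 then sg w else 0))"
      by (intro sum.cong) auto
    also have "\<dots> = int (card K) * (if int (asc w) = k then sg w else 0) +
        int (card ({..n} - K)) * (if int (asc w) = k - 1 then sg w else 0)"
      using K by (simp add: sum.If_cases Int_absorb1 Diff_eq)
    also have "int (card ({..n} - K)) = int (Suc n) - int (Suc (asc w))"
      using K fK cK card_mono[OF _ K] by (simp add: card_Diff_subset of_nat_diff)
    \<comment> \<open>Each coefficient matters only under its condition: \<open>asc w = k\<close>
      gives \<open>k + 1\<close> places in \<open>K\<close>, and \<open>asc w = k - 1\<close> leaves
      \<open>n + 1 - k\<close> places outside it.\<close>
    finally show "(\<Sum>j\<le>n. if int (asc (insert_at j w (Suc n))) = k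
            then ?h (insert_at j w (Suc n)) * sg (insert_at j w (Suc n)) else 0) =
        (int (Suc n) - k) * (if int (asc w) = k - 1 then sg w else 0) +
        (k + 1) * (if int (asc w) = k then sg w else 0)"
      using cK by auto
  qed
  finally show ?thesis
    by (simp add: D_num_eq_sum_permutations sum.distrib sum_distrib_left)
qed

text \<open>As both sides of the maximum are nonempty, it contributes one ascent before and after
  the involution. Its inversions change from \<open>length v\<close> to \<open>length u\<close>, and
  these add up to the odd number \<open>n\<close>, so the sign flips.\<close>

lemma sum_sg_max_interior:
  assumes n: "odd n"
  shows "(\<Sum>w | w \<in> E_set (Suc n) k \<and> hd w \<noteq> Suc n \<and> last w \<noteq> Suc n. sg w) = 0"
proof -
  let ?A = "{w. w \<in> E_set (Suc n) k \<and> hd w \<noteq> Suc n \<and> last w \<noteq> Suc n}"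
  \<comment> \<open>\<open>Suc n - x\<close> permutes \<open>{1..n}\<close> but would send
    \<open>Suc n\<close> to 0, so that value is fixed separately.\<close>
  define c where "c x = (if x = Suc n then x else Suc n - x)" for x
  define f where "f w = rev (map c w)" for w
  have f: "f w \<in> ?A \<and> f (f w) = w \<and> sg (f w) = - sg w" if w: "w \<in> ?A" for w
  proof -
    have d: "distinct w" and s: "set w = {1..Suc n}" and l: "length w = Suc n"
      using w permutations_of_set_atLeastAtMostD[of w "Suc n"] by (simp_all add: E_set_def)
    then have "Suc n \<in> set w" by auto
    then obtain u v where uv: "w = u @ Suc n # v" by (meson split_list)
    have ne: "u \<noteq> []" "v \<noteq> []" using w by (auto simp: uv)
    have "set (u @ v) = set w - {Suc n}" using d by (auto simp: uv)
    then have lt: "\<forall>x\<in>set (u @ v). 1 \<le> x \<and> x < Suc n" using s by auto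
    have le: "\<forall>x\<in>set u. x \<le> Suc n" "\<forall>x\<in>set v. x \<le> Suc n"
      using equalityD1[OF s] by (auto simp: uv)
    have ltn: "\<forall>x\<in>set u \<union> set v. x < Suc n" using bspec[OF lt] by simp
    have fw: "f w = rev_compl (Suc n) v @ Suc n # rev_compl (Suc n) u"
      using lt by (auto simp: f_def uv c_def rev_compl_def)
    have lt': "\<forall>x\<in>set (rev_compl (Suc n) v) \<union> set (rev_compl (Suc n) u). x < Suc n"
    proof -
      have "Suc n - x < Suc n" if "x \<in> set (u @ v)" for x
        using bspec[OF lt that] by auto
      then show ?thesis by (auto simp: rev_compl_def)
    qed
    have "asc (f w) = asc (rev_compl (Suc n) v) + asc (rev_compl (Suc n) u) + 1"
      using asc_insert_max[OF lt'] ne by (simp add: fw)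
    also have "asc (rev_compl (Suc n) v) = asc v"
      by (rule asc_rev_compl[OF le(2)])
    also have "asc (rev_compl (Suc n) u) = asc u"
      by (rule asc_rev_compl[OF le(1)])
    also have "asc v + asc u + 1 = asc w"
      using asc_insert_max[OF ltn] ne by (simp add: uv)
    finally have "asc (f w) = asc w" .
    moreover have "inv_num (f w) + inv_num w = 2 * inv_num (u @ v) + n"
    proof -
      have "inv_num (f w) = inv_num (rev_compl (Suc n) (u @ v)) + length u"
        using inv_num_insert_max[OF lt'] by (simp add: fw rev_compl_def)
      moreover have "inv_num (rev_compl (Suc n) (u @ v)) = inv_num (u @ v)"
        by (rule inv_num_rev_compl) (use le in \<open>simp add: ball_Un\<close>)
      moreover have "inv_num w = inv_num (u @ v) + length v"
        unfolding uv by (rule inv_num_insert_max[OF ltn])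
      ultimately show ?thesis using l by (simp add: uv)
    qed
    then have "odd (inv_num (f w) + inv_num w)" using n by simp
    then have "sg (f w) = - sg w" by (auto simp: sg_def minus_one_power_iff)
    moreover have cc: "c (c x) = x" if "x \<in> {1..Suc n}" for x
      using that by (auto simp: c_def)
    have "f (f w) = w"
      using cc s by (auto simp: f_def rev_map intro!: map_idI)
    moreover have "c ` {1..Suc n} = {1..Suc n}"
    proof -
      have *: "c ` {1..Suc n} \<subseteq> {1..Suc n}" by (auto simp: c_def)
      moreover have "{1..Suc n} \<subseteq> c ` {1..Suc n}"
      proof
        fix x assume "x \<in> {1..Suc n}"
        then show "x \<in> c ` {1..Suc n}" using cc[of x] * by (metis image_eqI image_subset_iff)
      qed
      ultimately show ?thesis by blast
    qed
    then have "f w \<in> permutations_of_set {1..Suc n}"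
      using d s inj_on_inverseI[of "{1..Suc n}" c c] cc
      by (auto simp: f_def permutations_of_set_def distinct_map)
    moreover have "hd (f w) \<noteq> Suc n" "last (f w) \<noteq> Suc n"
      using ne bspec[OF lt', of "hd (rev_compl (Suc n) v)"]
        bspec[OF lt', of "last (rev_compl (Suc n) u)"]
      by (auto simp: fw)
    ultimately show ?thesis using w by (auto simp: E_set_def)
  qed
  show ?thesis by (rule sum_sign_reversing_involution[of _ f]) (use f in blast)+
qed

text \<open>Of the two surviving places, the front creates \<open>n\<close> inversions, an odd
  number, and no ascent; the end creates no inversion and one ascent.\<close>

lemma D_num_even:
  assumes n: "odd n"
  shows "D_num (Suc n) k = D_num n (k - 1) - D_num n k"
proof -
  have "sum sg (E_set (Suc n) k) =
      (\<Sum>w | w \<in> E_set (Suc n) k. if hd w = Suc n \<or> last w = Suc n then sg w else 0) +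
      (\<Sum>w | w \<in> E_set (Suc n) k. if hd w \<noteq> Suc n \<and> last w \<noteq> Suc n then sg w else 0)"
    by (subst sum.distrib[symmetric]) (auto intro: sum.cong)
  also have "(\<Sum>w | w \<in> E_set (Suc n) k. if hd w \<noteq> Suc n \<and> last w \<noteq> Suc n then sg w else 0) =
      (\<Sum>w | w \<in> E_set (Suc n) k \<and> hd w \<noteq> Suc n \<and> last w \<noteq> Suc n. sg w)"
    by (intro sum.mono_neutral_cong_right) auto
  also have "\<dots> = 0" by (rule sum_sg_max_interior[OF n])
  finally have "D_num (Suc n) k =
      (\<Sum>w | w \<in> E_set (Suc n) k. if hd w = Suc n \<or> last w = Suc n then sg w else 0)"
    by (simp add: D_num_eq_sum)
  also have "\<dots> = (\<Sum>w\<in>permutations_of_set {1..n}.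
      (if int (asc w) = k - 1 then sg w else 0) - (if int (asc w) = k then sg w else 0))"
    unfolding sum_E_set_Suc
  proof (rule sum.cong[OF refl])
    fix w assume w: "w \<in> permutations_of_set {1..n}"
    then have d: "distinct w" and s: "set w = {1..n}" and l: "length w = n"
      by (rule permutations_of_set_atLeastAtMostD)+
    have m: "\<forall>x\<in>set w. x < Suc n" using s by auto
    have n0: "n \<noteq> 0" using n by (cases n) auto
    let ?g = "\<lambda>j. if int (asc (insert_at j w (Suc n))) = k then
        if hd (insert_at j w (Suc n)) = Suc n \<or> last (insert_at j w (Suc n)) = Suc n
        then sg (insert_at j w (Suc n)) else 0 else 0"
    \<comment> \<open>Strictly inside, both ends of the new word are entries of \<open>w\<close>,
      hence below \<open>Suc n\<close>.\<close>
    have "?g j = 0" if "j \<in> {..n} - {0, n}" for j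
    proof -
      have j: "0 < j" "j < n" using that by auto
      then have "take j w \<noteq> []" "drop j w \<noteq> []" using l by auto
      then have "hd (insert_at j w (Suc n)) \<in> set w" "last (insert_at j w (Suc n)) \<in> set w"
        using hd_in_set[of "take j w"] last_in_set[of "drop j w"]
        by (auto simp: insert_at_def dest: in_set_takeD in_set_dropD)
      then show ?thesis using s by auto
    qed
    then have "sum ?g {..n} = sum ?g {0, n}"
      by (intro sum.mono_neutral_right) auto
    also have "\<dots> = ?g 0 + ?g n" using n0 by simp
    also have "?g 0 = - (if int (asc w) = k then sg w else 0)"
      using sg_insert_at[OF m, of 0] asc_insert_at[OF m, of 0] n l
      by (auto simp: insert_at_def)
    \<comment> \<open>The last index of \<open>w\<close> is never an ascent, so insertion at the end
      always adds one.\<close>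
    also have "n - 1 \<notin> ascents w" using l n0 by (simp add: ascents_def)
    then have "?g n = (if int (asc w) = k - 1 then sg w else 0)"
      using sg_insert_at[OF m, of n] asc_insert_at[OF m, of n] l n0
      by (auto simp: insert_at_def)
    finally show "sum ?g {..n} =
        (if int (asc w) = k - 1 then sg w else 0) - (if int (asc w) = k then sg w else 0)"
      by simp
  qed
  finally show ?thesis by (simp add: D_num_eq_sum_permutations sum_subtractf)
qed

theorem theorem4p3:
  shows "(\<forall>(n::nat) (k::int). n \<ge> 1 \<and> 0 \<le> k \<and> k \<le> int n - 1 \<longrightarrow> R_num n k = D_num n k) \<and>
         (\<forall>(n::nat) (k::int). n \<ge> 2 \<and> 0 \<le> k \<and> k \<le> int n - 1 \<longrightarrow>
            R_num n k =
              (if odd n then (int n - k) * R_num (n - 1) (k - 1) + (k + 1) * R_num (n - 1) k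
               else R_num (n - 1) (k - 1) - R_num (n - 1) k))"
proof (intro conjI allI impI)
  fix n :: nat and k :: int
  assume "n \<ge> 2 \<and> 0 \<le> k \<and> k \<le> int n - 1"
  then obtain m where "n = Suc m" by (cases n) auto
  then show "R_num n k =
      (if odd n then (int n - k) * R_num (n - 1) (k - 1) + (k + 1) * R_num (n - 1) k
       else R_num (n - 1) (k - 1) - R_num (n - 1) k)"
    using D_num_odd[of m k] D_num_even[of m k] by (simp add: R_num_eq_D_num)
qed (rule R_num_eq_D_num)

end
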